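(* Let $\mathbb K$ be a field, $s,d\in\mathbb N$, and let $\mathcal R$ be a nc Fornasini--Marchesini realization centred at $\underline Y\in(\mathbb K^{s\times s})^d$ that is described by $(L;D,C,\underline{\mathbf A},\underline{\mathbf B})$. Suppose $\mathcal R$ is controllable and observable, and its coefficients satisfy the linearized lost-abbey conditions. Then $\Omega(\mathcal R)=\coprod_m\Omega_{sm}(\mathcal R)$ is similarity invariant, i.e., for every $m\in\mathbb N$ and every invertible $S\in\mathbb K^{sm\times sm}$, $$\underline X=(X_1,\ldots,X_d)\in\Omega_{sm}(\mathcal R)\ \Longrightarrow\ S\cdot\underline X\cdot S^{-1}=(SX_1S^{-1},\ldots,SX_dS^{-1})\in\Omega_{sm}(\mathcal R).$$
   Context: Realizations. A nc Fornasini--Marchesini realization $\mathcal R$ centred at $\underline Y=(Y_1,\ldots,Y_d)\in(\mathbb K^{s\times s})^d$, described by $(L;D,C,\underline{\mathbf A},\underline{\mathbf B})$, consists of $L\in\mathbb N$, linear maps $\mathbf A_k:\mathbb K^{s\times s}\to\mathbb K^{L\times L}$, $\mathbf B_k:\mathbb K^{s\times s}\to\mathbb K^{L\times s}$ ($1\le k\le d$), and matrices $C\in\mathbb K^{s\times L}$, $D\in\mathbb K^{s\times s}$. A linear map $\mathbf T$ on $\mathbb K^{s\times s}$ is extended to $X=[X_{ij}]\in\mathbb K^{sm\times sm}$ with $s\times s$ blocks by $(X)\mathbf T=[\mathbf T(X_{ij})]$. For $\underline X\in(\mathbb K^{sm\times sm})^d$ put $\Lambda_{\underline{\mathbf A},\underline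 Y}(\underline X)=I_{Lm}-\sum_k(X_k-I_m\otimes Y_k)\mathbf A_k$ and $\Omega_{sm}(\mathcal R)=\{\underline X\in(\mathbb K^{sm\times sm})^d:\det\Lambda_{\underline{\mathbf A},\underline Y}(\underline X)\ne0\}$. $\otimes$ is the Kronecker product $P\otimes Q=[p_{ij}Q]$. Controllable: the sum of the column spaces of all matrices $\mathbf A_{i_1}(X_1)\cdots\mathbf A_{i_\ell}(X_\ell)\mathbf B_k(X_{\ell+1})$ ($\ell\ge0$, $1\le i_1,\ldots,i_\ell,k\le d$, $X_j\in\mathbb K^{s\times s}$) is $\mathbb K^L$. Observable: the intersection of the kernels of all $C\mathbf A_{i_1}(X_1)\cdots\mathbf A_{i_\ell}(X_\ell)$ ($\ell\ge0$) is $\{0\}$. Linearized lost-abbey conditions: with $[S,Y]=SY-YS$, for all $S,Z_1,Z_2\in\mathbb K^{s\times s}$ and $1\le i_1,i_2\le d$: $SD-DS=C\sum_k\mathbf B_k([S,Y_k])$; $SC\mathbf B_{i_1}(Z_1)-C\mathbf B_{i_1}(SZ_1)=C\big(\sum_k\mathbf A_k([S,Y_k])\big)\mathbf B_{i_1}(Z_1)$; $SC\mathbf A_{i_1}(Z_1)-C\mathbf A_{i_1}(SZ_1)=C\big(\sum_k\mathbf A_k([S,Y_k])\big)\mathbf A_{i_1}(Z_1)$; $\mathbf B_{i_1}(Z_1S)-\mathbf B_{i_1}(Z_1)S=\mathbf A_{i_1}(Z_1)\sum_k\mathbf B_k([S,Y_k])$; $\mathbf A_{i_1}(Z_1S)\mathbf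 B_{i_2}(Z_2)-\mathbf A_{i_1}(Z_1)\mathbf B_{i_2}(SZ_2)=\mathbf A_{i_1}(Z_1)\big(\sum_k\mathbf A_k([S,Y_k])\big)\mathbf B_{i_2}(Z_2)$; $\mathbf A_{i_1}(Z_1S)\mathbf A_{i_2}(Z_2)-\mathbf A_{i_1}(Z_1)\mathbf A_{i_2}(SZ_2)=\mathbf A_{i_1}(Z_1)\big(\sum_k\mathbf A_k([S,Y_k])\big)\mathbf A_{i_2}(Z_2)$ (sums over $k=1,\ldots,d$). *)

theory Defs
  imports
    "Jordan_Normal_Form.Determinant"
    "Jordan_Normal_Form.Matrix_Kernel"
    "Jordan_Normal_Form.VS_Connect"
begin

text \<open>
  A tuple $\underline{X} = (X_1,\ldots,X_d)$ is a function on \<open>nat\<close> of which only the values at the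
  indices \<open>0, \<dots>, d - 1\<close> are used.
\<close>

abbreviation mat_sum :: "nat \<Rightarrow> nat \<Rightarrow> nat \<Rightarrow> (nat \<Rightarrow> 'a::field mat) \<Rightarrow> 'a mat" where
  "mat_sum nr nc d M \<equiv> (\<Oplus>\<^bsub>module_mat TYPE('a) nr nc\<^esub>k\<in>{..<d}. M k)"

definition mat_linear_maps :: "nat \<Rightarrow> nat \<Rightarrow> nat \<Rightarrow> ('a::field mat \<Rightarrow> 'a mat) set" where
  "mat_linear_maps s p q =
     LinearCombinations.module_hom class_ring (module_mat TYPE('a) s s) (module_mat TYPE('a) p q)"

definition kronecker :: "'a::semiring_0 mat \<Rightarrow> 'a mat \<Rightarrow> 'a mat" where
  "kronecker P Q = mat (dim_row P * dim_row Q) (dim_col P * dim_col Q)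
     (\<lambda>(i, j). P $$ (i div dim_row Q, j div dim_col Q) * Q $$ (i mod dim_row Q, j mod dim_col Q))"

text \<open>The block \<open>X\<^bsub>ij\<^esub>\<close> of size \<open>s \<times> s\<close>; blocks are numbered from 0.\<close>

definition mat_block :: "nat \<Rightarrow> 'a mat \<Rightarrow> nat \<Rightarrow> nat \<Rightarrow> 'a mat" where
  "mat_block s X i j = mat s s (\<lambda>(a, b). X $$ (i * s + a, j * s + b))"

text \<open>
  The extension \<open>(X)T = [T(X\<^bsub>ij\<^esub>)]\<close> to an \<open>m \<times> m\<close> array of blocks,
  where \<open>T\<close> maps \<open>s \<times> s\<close> matrices to \<open>p \<times> q\<close> matrices.
\<close>

definition map_blocks ::
  "nat \<Rightarrow> nat \<Rightarrow> nat \<Rightarrow> nat \<Rightarrow> ('a mat \<Rightarrow> 'a mat) \<Rightarrow> 'a mat \<Rightarrow> 'a mat" where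
  "map_blocks s p q m T X = mat (p * m) (q * m)
     (\<lambda>(i, j). T (mat_block s X (i div p) (j div q)) $$ (i mod p, j mod q))"

definition fm_realization ::
  "nat \<Rightarrow> nat \<Rightarrow> (nat \<Rightarrow> 'a::field mat) \<Rightarrow> nat \<Rightarrow> 'a mat \<Rightarrow> 'a mat \<Rightarrow>
   (nat \<Rightarrow> 'a mat \<Rightarrow> 'a mat) \<Rightarrow> (nat \<Rightarrow> 'a mat \<Rightarrow> 'a mat) \<Rightarrow> bool" where
  "fm_realization s d Y L D C A B \<longleftrightarrow>
     (\<forall>k<d. Y k \<in> carrier_mat s s) \<and>
     D \<in> carrier_mat s s \<and>
     C \<in> carrier_mat s L \<and>
     (\<forall>k<d. A k \<in> mat_linear_maps s L L) \<and>
     (\<forall>k<d. B k \<in> mat_linear_maps s L s)"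

definition fm_Lambda ::
  "nat \<Rightarrow> nat \<Rightarrow> (nat \<Rightarrow> 'a::field mat) \<Rightarrow> nat \<Rightarrow> (nat \<Rightarrow> 'a mat \<Rightarrow> 'a mat) \<Rightarrow>
   nat \<Rightarrow> (nat \<Rightarrow> 'a mat) \<Rightarrow> 'a mat" where
  "fm_Lambda s d Y L A m X =
     1\<^sub>m (L * m)
     - mat_sum (L * m) (L * m) d (\<lambda>k. map_blocks s L L m (A k) (X k - kronecker (1\<^sub>m m) (Y k)))"

definition fm_Omega_level ::
  "nat \<Rightarrow> nat \<Rightarrow> (nat \<Rightarrow> 'a::field mat) \<Rightarrow> nat \<Rightarrow> (nat \<Rightarrow> 'a mat \<Rightarrow> 'a mat) \<Rightarrow>
   nat \<Rightarrow> (nat \<Rightarrow> 'a mat) set" where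
  "fm_Omega_level s d Y L A m =
     {X. (\<forall>k<d. X k \<in> carrier_mat (s * m) (s * m)) \<and> det (fm_Lambda s d Y L A m X) \<noteq> 0}"

definition fm_Omega ::
  "nat \<Rightarrow> nat \<Rightarrow> (nat \<Rightarrow> 'a::field mat) \<Rightarrow> nat \<Rightarrow> (nat \<Rightarrow> 'a mat \<Rightarrow> 'a mat) \<Rightarrow>
   (nat \<times> (nat \<Rightarrow> 'a mat)) set" where
  "fm_Omega s d Y L A = (SIGMA m:UNIV. fm_Omega_level s d Y L A m)"

definition similarity_invariant :: "nat \<Rightarrow> (nat \<times> (nat \<Rightarrow> 'a::field mat)) set \<Rightarrow> bool" where
  "similarity_invariant s W \<longleftrightarrow>
     (\<forall>m. \<forall>S \<in> carrier_mat (s * m) (s * m). \<forall>T \<in> carrier_mat (s * m) (s * m).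
        inverts_mat S T \<and> inverts_mat T S \<longrightarrow>
        (\<forall>X. (m, X) \<in> W \<longrightarrow> (m, \<lambda>k. S * X k * T) \<in> W))"

text \<open>
  The word \<open>[(i\<^sub>1, X\<^sub>1), \<dots>, (i\<^sub>l, X\<^sub>l)]\<close> stands for the product
  \<open>A\<^bsub>i\<^sub>1\<^esub>(X\<^sub>1) \<cdots> A\<^bsub>i\<^sub>l\<^esub>(X\<^sub>l)\<close>, and the empty word for the identity.
\<close>

definition fm_words :: "nat \<Rightarrow> nat \<Rightarrow> (nat \<times> 'a mat) list set" where
  "fm_words s d = lists ({..<d} \<times> carrier_mat s s)"

definition word_prod ::
  "nat \<Rightarrow> (nat \<Rightarrow> 'a mat \<Rightarrow> 'a::field mat) \<Rightarrow> (nat \<times> 'a mat) list \<Rightarrow> 'a mat" where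
  "word_prod L A w = foldr (\<lambda>(i, X) P. A i X * P) w (1\<^sub>m L)"

text \<open>The sum of a family of subspaces is the span of their union.\<close>

definition fm_controllable ::
  "nat \<Rightarrow> nat \<Rightarrow> nat \<Rightarrow> (nat \<Rightarrow> 'a::field mat \<Rightarrow> 'a mat) \<Rightarrow>
   (nat \<Rightarrow> 'a mat \<Rightarrow> 'a mat) \<Rightarrow> bool" where
  "fm_controllable s d L A B \<longleftrightarrow>
     LinearCombinations.module.span class_ring (module_vec TYPE('a) L)
       (\<Union>w \<in> fm_words s d. \<Union>k \<in> {..<d}. \<Union>X \<in> carrier_mat s s.
          vec_space.col_space L (word_prod L A w * B k X))
     = carrier_vec L"

definition fm_observable ::
  "nat \<Rightarrow> nat \<Rightarrow> nat \<Rightarrow> 'a::field mat \<Rightarrow> (nat \<Rightarrow> 'a mat \<Rightarrow> 'a mat) \<Rightarrow> bool" where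
  "fm_observable s d L C A \<longleftrightarrow>
     (\<Inter>w \<in> fm_words s d. mat_kernel (C * word_prod L A w)) = {0\<^sub>v L}"

definition mat_commutator :: "'a::field mat \<Rightarrow> 'a mat \<Rightarrow> 'a mat" where
  "mat_commutator S Y = S * Y - Y * S"

definition linearized_lost_abbey ::
  "nat \<Rightarrow> nat \<Rightarrow> (nat \<Rightarrow> 'a::field mat) \<Rightarrow> nat \<Rightarrow> 'a mat \<Rightarrow> 'a mat \<Rightarrow>
   (nat \<Rightarrow> 'a mat \<Rightarrow> 'a mat) \<Rightarrow> (nat \<Rightarrow> 'a mat \<Rightarrow> 'a mat) \<Rightarrow> bool" where
  "linearized_lost_abbey s d Y L D C A B \<longleftrightarrow>
     (\<forall>S \<in> carrier_mat s s.
        let sumA = mat_sum L L d (\<lambda>k. A k (mat_commutator S (Y k)));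
            sumB = mat_sum L s d (\<lambda>k. B k (mat_commutator S (Y k)))
        in S * D - D * S = C * sumB \<and>
           (\<forall>Z1 \<in> carrier_mat s s. \<forall>i1<d.
              S * C * B i1 Z1 - C * B i1 (S * Z1) = C * sumA * B i1 Z1 \<and>
              S * C * A i1 Z1 - C * A i1 (S * Z1) = C * sumA * A i1 Z1 \<and>
              B i1 (Z1 * S) - B i1 Z1 * S = A i1 Z1 * sumB) \<and>
           (\<forall>Z1 \<in> carrier_mat s s. \<forall>Z2 \<in> carrier_mat s s. \<forall>i1<d. \<forall>i2<d.
              A i1 (Z1 * S) * B i2 Z2 - A i1 Z1 * B i2 (S * Z2) = A i1 Z1 * sumA * B i2 Z2 \<and>
              A i1 (Z1 * S) * A i2 Z2 - A i1 Z1 * A i2 (S * Z2) = A i1 Z1 * sumA * A i2 Z2))"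

end

theory Submission
  imports Defs
begin

text \<open>
  Write \<open>a(Z) = \<Sum>\<^sub>k A\<^sub>k(Z\<^sub>k)\<close> and let \<open>Y\<close> also stand for \<open>I\<^sub>m \<otimes> Y\<close>. By linearity the last lost-abbey
  condition passes to block matrices: \<open>A\<^sub>i(ZS) A\<^sub>j(W) - A\<^sub>i(Z) A\<^sub>j(SW) = A\<^sub>i(Z) a([S,Y]) A\<^sub>j(W)\<close>.
  Put \<open>N = X - Y\<close> and \<open>N' = SXS\<^sup>-\<^sup>1 - Y\<close>, so that \<open>N'S = SN + [S,Y]\<close>, and let the row vector \<open>v\<close>
  satisfy \<open>v = v a(N')\<close>. Summing the condition over \<open>Z = N'\<^sub>i\<close> gives \<open>v A\<^sub>j(SW) = u A\<^sub>j(W)\<close> with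
  \<open>u = v a(SN)\<close>. The choice \<open>W = N\<^sub>j\<close> yields \<open>u = u a(N)\<close>, hence \<open>u = 0\<close> when \<open>I - a(N)\<close> is
  invertible; then \<open>W = S\<^sup>-\<^sup>1N'\<^sub>j\<close> yields \<open>v = v a(N') = 0\<close>.
\<close>

section \<open>Finite sums of matrices\<close>

text \<open>Addition of matrices takes its dimensions from the second summand. In the induction this
  is the shorter sum, so its size must be known before an entry can be read off; hence the two
  claims share one induction.\<close>

lemma mat_sum_carrier_index:
  fixes M :: "nat \<Rightarrow> 'a::field mat"
  assumes "\<And>k. k < d \<Longrightarrow> M k \<in> carrier_mat nr nc"
  shows "mat_sum nr nc d M \<in> carrier_mat nr nc \<and>
    (\<forall>i<nr. \<forall>j<nc. mat_sum nr nc d M $$ (i, j) = (\<Sum>k<d. M k $$ (i, j)))"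
  using assms
proof (induction d)
  case 0
  interpret abelian_group "module_mat TYPE('a) nr nc" by (rule abelian_group_mat)
  show ?case by (simp add: module_mat_simps)
next
  case (Suc d)
  interpret abelian_group "module_mat TYPE('a) nr nc" by (rule abelian_group_mat)
  have "mat_sum nr nc (Suc d) M = M d + mat_sum nr nc d M"
    unfolding lessThan_Suc
    by (subst finsum_insert) (use Suc.prems in \<open>auto simp: module_mat_simps\<close>)
  with Suc.IH Suc.prems show ?case
    by (auto simp: algebra_simps)
qed

lemma mat_sum_carrier:
  fixes M :: "nat \<Rightarrow> 'a::field mat"
  assumes "\<And>k. k < d \<Longrightarrow> M k \<in> carrier_mat nr nc"
  shows "mat_sum nr nc d M \<in> carrier_mat nr nc"
  by (rule conjunct1[OF mat_sum_carrier_index]) (rule assms)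

lemma index_mat_sum:
  fixes M :: "nat \<Rightarrow> 'a::field mat"
  assumes "\<And>k. k < d \<Longrightarrow> M k \<in> carrier_mat nr nc" "i < nr" "j < nc"
  shows "mat_sum nr nc d M $$ (i, j) = (\<Sum>k<d. M k $$ (i, j))"
  using conjunct2[OF mat_sum_carrier_index[of d M nr nc]] assms by simp

lemma mat_sum_cong:
  assumes "\<And>k. k < d \<Longrightarrow> M k = M' k" "\<And>k. k < d \<Longrightarrow> M' k \<in> carrier_mat nr nc"
  shows "mat_sum nr nc d M = mat_sum nr nc d M'"
proof -
  have "M k \<in> carrier_mat nr nc" if "k < d" for k using assms that by simp
  note c = mat_sum_carrier[of d M, OF this] mat_sum_carrier[of d M', OF assms(2)]
    index_mat_sum[of d M, OF this] index_mat_sum[of d M', OF assms(2)]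
  show ?thesis
    by (rule eq_matI) (use c(1,2) in \<open>auto simp: c(3,4) assms(1)\<close>)
qed

lemma mat_sum_Suc:
  fixes M :: "nat \<Rightarrow> 'a::field mat"
  assumes "\<And>k. k < Suc d \<Longrightarrow> M k \<in> carrier_mat nr nc"
  shows "mat_sum nr nc (Suc d) M = mat_sum nr nc d M + M d"
proof -
  have a: "k < d \<Longrightarrow> M k \<in> carrier_mat nr nc" for k using assms by simp
  note c = mat_sum_carrier[of "Suc d" M, OF assms] mat_sum_carrier[of d M, OF a]
    index_mat_sum[of "Suc d" M, OF assms] index_mat_sum[of d M, OF a]
  show ?thesis
    by (rule eq_matI) (use c(1,2) assms[of d] in \<open>auto simp: c(3,4)\<close>)
qed

lemma mat_sum_0: "mat_sum nr nc 0 M = (0\<^sub>m nr nc :: 'a::field mat)"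
proof -
  interpret abelian_group "module_mat TYPE('a) nr nc" by (rule abelian_group_mat)
  show ?thesis by (simp add: module_mat_simps)
qed

text \<open>The empty sum is the only delicate case: \<open>T 0 = T 0 + T 0\<close> forces
  \<open>T 0 = 0\<close> by cancellation on entries. The lemma serves multiplication by a fixed
  matrix on either side as well as the coefficient maps \<open>A k\<close>.\<close>

lemma additive_mat_sum:
  fixes M :: "nat \<Rightarrow> 'a::field mat" and T :: "'a mat \<Rightarrow> 'a mat"
  assumes T: "\<And>X. X \<in> carrier_mat nr nc \<Longrightarrow> T X \<in> carrier_mat p q"
    and add: "\<And>X X'. X \<in> carrier_mat nr nc \<Longrightarrow> X' \<in> carrier_mat nr nc \<Longrightarrow> T (X + X') = T X + T X'"
    and M: "\<And>k. k < d \<Longrightarrow> M k \<in> carrier_mat nr nc"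
  shows "T (mat_sum nr nc d M) = mat_sum p q d (\<lambda>k. T (M k))"
  using M
proof (induction d)
  case 0
  define Z where "Z = T (0\<^sub>m nr nc)"
  have Z: "Z \<in> carrier_mat p q" unfolding Z_def by (rule T) simp
  have ZZ: "Z = Z + Z" unfolding Z_def using add[of "0\<^sub>m nr nc" "0\<^sub>m nr nc"] by simp
  have "Z $$ (i, j) = 0" if "i < p" "j < q" for i j
  proof -
    have "Z $$ (i, j) = Z $$ (i, j) + Z $$ (i, j)"
      using arg_cong[OF ZZ, of "\<lambda>M. M $$ (i, j)"] Z that
      by (simp only: index_add_mat carrier_matD)
    then show ?thesis by (simp only: add_cancel_right_right)
  qed
  then have "Z = 0\<^sub>m p q" using Z by (intro eq_matI) auto
  then show ?case by (simp only: mat_sum_0 Z_def)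
next
  case (Suc d)
  then show ?case
    by (subst (1 2) mat_sum_Suc) (auto simp: add T mat_sum_carrier)
qed

lemma mult_mat_sum:
  fixes P :: "'a::field mat"
  assumes "P \<in> carrier_mat p nr" "\<And>k. k < d \<Longrightarrow> M k \<in> carrier_mat nr nc"
  shows "P * mat_sum nr nc d M = mat_sum p nc d (\<lambda>k. P * M k)"
  by (rule additive_mat_sum[where T = "\<lambda>X. P * X", OF _ mult_add_distrib_mat[OF assms(1)] assms(2)])
    (use assms(1) in auto)

lemma mat_sum_mult:
  fixes P :: "'a::field mat"
  assumes "P \<in> carrier_mat nc q" "\<And>k. k < d \<Longrightarrow> M k \<in> carrier_mat nr nc"
  shows "mat_sum nr nc d M * P = mat_sum nr q d (\<lambda>k. M k * P)"
  by (rule additive_mat_sum[where T = "\<lambda>X. X * P", OF _ add_mult_distrib_mat[OF _ _ assms(1)] assms(2)])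
    (use assms(1) in auto)

lemma mat_sum_minus:
  fixes M :: "nat \<Rightarrow> 'a::field mat"
  assumes M: "\<And>k. k < d \<Longrightarrow> M k \<in> carrier_mat nr nc"
    and M': "\<And>k. k < d \<Longrightarrow> M' k \<in> carrier_mat nr nc"
  shows "mat_sum nr nc d (\<lambda>k. M k - M' k) = mat_sum nr nc d M - mat_sum nr nc d M'"
proof -
  have minus: "M k - M' k \<in> carrier_mat nr nc" if "k < d" for k
    using M' that by (auto intro: minus_carrier_mat)
  have c: "mat_sum nr nc d (\<lambda>k. M k - M' k) \<in> carrier_mat nr nc"
    "mat_sum nr nc d M' \<in> carrier_mat nr nc"
    by (rule mat_sum_carrier, use minus M' in auto)+
  have d: "k < d \<Longrightarrow> dim_row (M' k) = nr" "k < d \<Longrightarrow> dim_col (M' k) = nc" for k using M' by auto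
  show ?thesis
    by (rule eq_matI)
      (use c d in \<open>auto simp: index_mat_sum minus M M' sum_subtractf\<close>)
qed

lemma mat_sum_add:
  fixes M :: "nat \<Rightarrow> 'a::field mat"
  assumes M: "\<And>k. k < d \<Longrightarrow> M k \<in> carrier_mat nr nc"
    and M': "\<And>k. k < d \<Longrightarrow> M' k \<in> carrier_mat nr nc"
  shows "mat_sum nr nc d (\<lambda>k. M k + M' k) = mat_sum nr nc d M + mat_sum nr nc d M'"
proof -
  interpret abelian_group "module_mat TYPE('a) nr nc" by (rule abelian_group_mat)
  have "(\<lambda>k. M k) \<in> {..<d} \<rightarrow> carrier_mat nr nc" "(\<lambda>k. M' k) \<in> {..<d} \<rightarrow> carrier_mat nr nc"
    using M M' by auto
  then show ?thesis using finsum_addf[of M "{..<d}" M'] by (simp add: module_mat_simps)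
qed

section \<open>Linear maps between matrix spaces\<close>

lemma mat_linear_maps_carrier:
  fixes T :: "'a::field mat \<Rightarrow> 'a mat"
  assumes "T \<in> mat_linear_maps s p q" "X \<in> carrier_mat s s"
  shows "T X \<in> carrier_mat p q"
  using assms LinearCombinations.module_hom_closed[of T class_ring "module_mat TYPE('a) s s" "module_mat TYPE('a) p q"]
  by (auto simp: mat_linear_maps_def module_mat_simps)

lemma mat_linear_maps_add:
  fixes T :: "'a::field mat \<Rightarrow> 'a mat"
  assumes "T \<in> mat_linear_maps s p q" "X \<in> carrier_mat s s" "X' \<in> carrier_mat s s"
  shows "T (X + X') = T X + T X'"
  using assms LinearCombinations.module_hom_add[of T class_ring "module_mat TYPE('a) s s" "module_mat TYPE('a) p q" X X']
  by (auto simp: mat_linear_maps_def module_mat_simps)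

section \<open>Fixed row vectors of the conjugated tuple\<close>

text \<open>Blocks are kept out of the argument: \<open>E k\<close> stands for the blockwise
  extension of \<open>A k\<close>, and \<open>Y k\<close> for the Kronecker product of the identity
  with the centre. Row vectors are used because \<open>v\<close> then acts on the left factor of
  \<open>abbey\<close>, whose argument is summed over, while \<open>W\<close> in the right factor
  stays free for two different choices.\<close>

lemma kernel_transfer:
  fixes S T :: "'a::field mat" and E :: "nat \<Rightarrow> 'a mat \<Rightarrow> 'a mat"
  assumes S: "S \<in> carrier_mat r r" and T: "T \<in> carrier_mat r r"
    and ST: "S * T = 1\<^sub>m r" and TS: "T * S = 1\<^sub>m r"
    and Y: "\<And>k. k < d \<Longrightarrow> Y k \<in> carrier_mat r r"
    and X: "\<And>k. k < d \<Longrightarrow> X k \<in> carrier_mat r r"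
    and E: "\<And>k Z. k < d \<Longrightarrow> Z \<in> carrier_mat r r \<Longrightarrow> E k Z \<in> carrier_mat n n"
    and E_add: "\<And>k Z W. k < d \<Longrightarrow> Z \<in> carrier_mat r r \<Longrightarrow> W \<in> carrier_mat r r \<Longrightarrow>
      E k (Z + W) = E k Z + E k W"
    and abbey: "\<And>i j Z W. i < d \<Longrightarrow> j < d \<Longrightarrow> Z \<in> carrier_mat r r \<Longrightarrow> W \<in> carrier_mat r r \<Longrightarrow>
      E i (Z * S) * E j W - E i Z * E j (S * W) =
      E i Z * mat_sum n n d (\<lambda>k. E k (mat_commutator S (Y k))) * E j W"
    and inj: "\<And>u. u \<in> carrier_mat 1 n \<Longrightarrow>
      u = u * mat_sum n n d (\<lambda>k. E k (X k - Y k)) \<Longrightarrow> u = 0\<^sub>m 1 n"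
    and v: "v \<in> carrier_mat 1 n"
    and v_eq: "v = v * mat_sum n n d (\<lambda>k. E k (S * X k * T - Y k))"
  shows "v = 0\<^sub>m 1 n"
proof -
  define N where "N k = X k - Y k" for k
  define N' where "N' k = S * X k * T - Y k" for k
  define K where "K k = mat_commutator S (Y k)" for k
  define a where "a Z = mat_sum n n d (\<lambda>k. E k (Z k))" for Z
  define u where "u = v * a (\<lambda>k. S * N k)"
  have N: "N k \<in> carrier_mat r r" and N': "N' k \<in> carrier_mat r r" and K: "K k \<in> carrier_mat r r"
    if "k < d" for k
    using X[OF that] Y[OF that] S T
    by (auto simp: N_def N'_def K_def mat_commutator_def intro!: minus_carrier_mat)
  have a: "a Z \<in> carrier_mat n n" if "\<And>k. k < d \<Longrightarrow> Z k \<in> carrier_mat r r" for Z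
    unfolding a_def by (rule mat_sum_carrier) (use that E in auto)
  have aN': "a N' \<in> carrier_mat n n" and aSN: "a (\<lambda>k. S * N k) \<in> carrier_mat n n"
    and aK: "a K \<in> carrier_mat n n" and aN'S: "a (\<lambda>k. N' k * S) \<in> carrier_mat n n"
    by (rule a; use N N' K S in \<open>blast intro: mult_carrier_mat\<close>)+
  have u: "u \<in> carrier_mat 1 n" unfolding u_def using v aSN by auto
  \<comment> \<open>Since \<open>T * S\<close> is the identity, the left side is
    \<open>S * X k - Y k * S\<close>; inserting \<open>S * Y k\<close> with both signs splits off
    the commutator.\<close>
  have N'S: "N' k * S = S * N k + K k" if "k < d" for k
  proof -
    have "N' k * S = S * X k * T * S - Y k * S"
      unfolding N'_def using S T X[OF that] Y[OF that]
      by (subst minus_mult_distrib_mat) auto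
    also have "S * X k * T * S = S * X k"
      using S T X[OF that] TS by (subst assoc_mult_mat[of _ r r _ r _ r]) auto
    also have "S * X k - Y k * S = S * N k + K k"
      unfolding N_def K_def mat_commutator_def using S X[OF that] Y[OF that]
      by (subst mult_minus_distrib_mat) auto
    finally show ?thesis .
  qed
  have split: "a (\<lambda>k. N' k * S) = a (\<lambda>k. S * N k) + a K"
  proof -
    have "a (\<lambda>k. N' k * S) = mat_sum n n d (\<lambda>k. E k (S * N k) + E k (K k))"
      unfolding a_def
      by (rule mat_sum_cong) (use N K S E in \<open>auto simp: N'S E_add\<close>)
    also have "\<dots> = a (\<lambda>k. S * N k) + a K"
      unfolding a_def by (rule mat_sum_add) (use N K S E in auto)
    finally show ?thesis .
  qed
  have vN': "v = v * a N'" using v_eq by (simp add: a_def N'_def)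
  \<comment> \<open>The condition \<open>abbey\<close> is taken at \<open>Z = N' i\<close>, summed
    over \<open>i\<close> and multiplied by \<open>v\<close> from the left. Wherever
    \<open>a N'\<close> then follows \<open>v\<close>, it is absorbed by
    \<open>v = v * a N'\<close>.\<close>
  have step: "v * E j (S * W) = u * E j W" if j: "j < d" and W: "W \<in> carrier_mat r r" for j W
  proof -
    have SW: "S * W \<in> carrier_mat r r" using S W by auto
    note Ej = E[OF j W] E[OF j SW]
    have EN': "E i (N' i) \<in> carrier_mat n n" "E i (N' i * S) \<in> carrier_mat n n" if "i < d" for i
      using E N'[OF that] S that by auto
    have "a (\<lambda>k. N' k * S) * E j W - a N' * E j (S * W)
      = mat_sum n n d (\<lambda>i. E i (N' i * S) * E j W) - mat_sum n n d (\<lambda>i. E i (N' i) * E j (S * W))"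
      unfolding a_def using Ej EN' by (simp add: mat_sum_mult[of _ n n])
    also have "\<dots> = mat_sum n n d (\<lambda>i. E i (N' i * S) * E j W - E i (N' i) * E j (S * W))"
      by (rule mat_sum_minus[symmetric]; use Ej EN' in \<open>blast intro: mult_carrier_mat\<close>)
    also have "\<dots> = mat_sum n n d (\<lambda>i. E i (N' i) * a K * E j W)"
      by (rule mat_sum_cong)
        (use abbey[OF _ j _ W] N' EN' Ej aK in \<open>auto simp: a_def K_def intro!: mult_carrier_mat\<close>)
    also have "\<dots> = mat_sum n n d (\<lambda>i. E i (N' i) * a K) * E j W"
      by (rule mat_sum_mult[symmetric]; use Ej EN' aK in \<open>blast intro: mult_carrier_mat\<close>)
    also have "mat_sum n n d (\<lambda>i. E i (N' i) * a K) = a N' * a K"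
      unfolding a_def[of N'] using EN' aK by (subst mat_sum_mult[of _ n n]) auto
    finally have "v * (a (\<lambda>k. N' k * S) * E j W - a N' * E j (S * W)) = v * (a N' * a K * E j W)"
      by simp
    also have "v * (a (\<lambda>k. N' k * S) * E j W - a N' * E j (S * W))
      = v * (a (\<lambda>k. N' k * S) * E j W) - v * (a N' * E j (S * W))"
      by (rule mult_minus_distrib_mat) (use v aN'S aN' Ej in auto)
    also have "v * (a N' * E j (S * W)) = v * E j (S * W)"
      using assoc_mult_mat[OF v aN' Ej(2)] vN' by simp
    also have "v * (a N' * a K * E j W) = v * (a K * E j W)"
      using assoc_mult_mat[OF v aN' mult_carrier_mat[OF aK Ej(1)]] assoc_mult_mat[OF aN' aK Ej(1)] vN'
      by simp
    \<comment> \<open>By \<open>split\<close>, the commutator contributes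
      \<open>v * (a K * E j W)\<close> here, exactly the term standing on the other side.\<close>
    also have "v * (a (\<lambda>k. N' k * S) * E j W)
      = u * E j W + v * (a K * E j W)"
      unfolding split u_def using v aSN aK Ej
      by (simp add: add_mult_distrib_mat[of _ n n] mult_add_distrib_mat[of _ 1 n _ n])
    finally have eq: "u * E j W + v * (a K * E j W) - v * E j (S * W) = v * (a K * E j W)" .
    define P where "P = u * E j W"
    define Q where "Q = v * (a K * E j W)"
    define R where "R = v * E j (S * W)"
    have c: "P \<in> carrier_mat 1 n" "Q \<in> carrier_mat 1 n" "R \<in> carrier_mat 1 n"
      unfolding P_def Q_def R_def using u v aK Ej by auto
    have PQR: "P + Q - R = Q" using eq unfolding P_def Q_def R_def .
    \<comment> \<open>The common term \<open>Q\<close> is cancelled on entries, where this is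
      cancellation in the field.\<close>
    have "P $$ (x, y) = R $$ (x, y)" if "x < 1" "y < n" for x y
    proof -
      have "(P + Q - R) $$ (x, y) = Q $$ (x, y)"
        by (simp only: PQR)
      then show ?thesis using c that by simp
    qed
    then have "R = P" using c by (intro eq_matI) auto
    then show ?thesis unfolding P_def R_def .
  qed
  have expand: "w * a Z = mat_sum 1 n d (\<lambda>k. w * E k (Z k))"
    if "w \<in> carrier_mat 1 n" "\<And>k. k < d \<Longrightarrow> Z k \<in> carrier_mat r r" for w Z
    unfolding a_def by (rule mult_mat_sum) (use that E in auto)
  \<comment> \<open>First choice in \<open>step\<close>: \<open>W = N k\<close> shows that
    \<open>u\<close> is fixed by \<open>a N\<close>, so that \<open>inj\<close> applies to
    it.\<close>
  have "u = mat_sum 1 n d (\<lambda>k. v * E k (S * N k))"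
    unfolding u_def using N S by (intro expand v) auto
  also have "\<dots> = mat_sum 1 n d (\<lambda>k. u * E k (N k))"
    by (rule mat_sum_cong) (use step N u E in auto)
  also have "\<dots> = u * a N"
    using N u by (intro expand[symmetric]) auto
  finally have u0: "u = 0\<^sub>m 1 n"
    using inj[OF u] by (simp add: a_def N_def)
  \<comment> \<open>Second choice in \<open>step\<close>: for \<open>W = T * N' k\<close> the
    product \<open>S * W\<close> is \<open>N' k\<close>, and the right side vanishes with
    \<open>u\<close>.\<close>
  have "v * E k (N' k) = 0\<^sub>m 1 n" if k: "k < d" for k
  proof -
    have "S * (T * N' k) = S * T * N' k"
      using S T N'[OF k] by (simp add: assoc_mult_mat[of _ r r _ r _ r])
    then have "S * (T * N' k) = N' k" using N'[OF k] ST by simp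
    then show ?thesis
      using step[OF k, of "T * N' k"] u0 T N'[OF k] E[OF k, of "T * N' k"] by simp
  qed
  then have "mat_sum 1 n d (\<lambda>k. v * E k (N' k)) = mat_sum 1 n d (\<lambda>k. 0\<^sub>m 1 n)"
    by (intro mat_sum_cong) auto
  also have "\<dots> = 0\<^sub>m 1 n"
    using mat_sum_carrier[of d "\<lambda>k. 0\<^sub>m 1 n :: 'a mat" 1 n] index_mat_sum[of d "\<lambda>k. 0\<^sub>m 1 n :: 'a mat" 1 n]
    by (intro eq_matI) auto
  finally show ?thesis
    using vN' expand[OF v, of N'] N' by simp
qed

section \<open>Determinants and fixed row vectors\<close>

text \<open>A row vector fixed by \<open>M\<close> is a kernel vector of the transpose of
  \<open>1 - M\<close>, and transposition preserves the determinant. Rows are written as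
  \<open>1 x n\<close> matrices so that the laws of the matrix product apply to them in
  \<open>kernel_transfer\<close>.\<close>

lemma det_one_minus_nonzero_iff:
  fixes M :: "'a::field mat"
  assumes M: "M \<in> carrier_mat n n"
  shows "det (1\<^sub>m n - M) \<noteq> 0 \<longleftrightarrow> (\<forall>u\<in>carrier_mat 1 n. u = u * M \<longrightarrow> u = 0\<^sub>m 1 n)"
proof -
  let ?B = "1\<^sub>m n - M"
  have B: "?B \<in> carrier_mat n n" using M by (intro minus_carrier_mat)
  have fix_iff: "u = u * M \<longleftrightarrow> ?B\<^sup>T *\<^sub>v row u 0 = 0\<^sub>v n" if u: "u \<in> carrier_mat 1 n" for u
  proof -
    have uB: "u * ?B = u - u * M"
      using u M by (subst mult_minus_distrib_mat[of _ 1 n]) auto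
    \<comment> \<open>Entry \<open>j\<close> on either side is the scalar product of
      \<open>u\<close> with column \<open>j\<close> of \<open>?B\<close>, only with the factors in
      opposite order.\<close>
    have "?B\<^sup>T *\<^sub>v row u 0 = row (u * ?B) 0"
      using u B M by (intro eq_vecI) (auto simp: comm_scalar_prod[of _ n])
    also have "\<dots> = row (u - u * M) 0" by (simp add: uB)
    also have "\<dots> = 0\<^sub>v n \<longleftrightarrow> u = u * M"
    proof
      assume "row (u - u * M) 0 = 0\<^sub>v n"
      then have "row (u - u * M) 0 $ j = 0" if "j < n" for j using that by simp
      then show "u = u * M" using u M by (intro eq_matI) auto
    next
      assume "u = u * M"
      then have "u $$ (0, j) = (u * M) $$ (0, j)" for j by simp
      then show "row (u - u * M) 0 = 0\<^sub>v n" using u M by (intro eq_vecI) auto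
    qed
    finally show ?thesis by simp
  qed
  have zero_iff: "u = 0\<^sub>m 1 n \<longleftrightarrow> row u 0 = 0\<^sub>v n" if u: "u \<in> carrier_mat 1 n" for u
  proof
    assume "row u 0 = 0\<^sub>v n"
    then have "row u 0 $ j = 0" if "j < n" for j using that by simp
    then show "u = 0\<^sub>m 1 n" using u by (intro eq_matI) auto
  qed auto
  have "det ?B \<noteq> 0 \<longleftrightarrow> (\<forall>v\<in>carrier_vec n. ?B\<^sup>T *\<^sub>v v = 0\<^sub>v n \<longrightarrow> v = 0\<^sub>v n)"
    using det_0_iff_vec_prod_zero_field[of "?B\<^sup>T" n] det_transpose[OF B] B by auto
  also have "\<dots> \<longleftrightarrow> (\<forall>u\<in>carrier_mat 1 n. ?B\<^sup>T *\<^sub>v row u 0 = 0\<^sub>v n \<longrightarrow> row u 0 = 0\<^sub>v n)"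
  proof -
    \<comment> \<open>Every vector of length \<open>n\<close> is the row of a \<open>1 x n\<close>
      matrix and conversely, so the two quantifiers range over the same objects.\<close>
    have "v = row (mat_of_rows n [v]) 0 \<and> mat_of_rows n [v] \<in> carrier_mat 1 n" if "v \<in> carrier_vec n" for v :: "'a vec"
      using that by (auto simp: mat_of_rows_def)
    moreover have "row u 0 \<in> carrier_vec n" if "u \<in> carrier_mat 1 n" for u :: "'a mat"
      using that by auto
    ultimately show ?thesis by metis
  qed
  also have "\<dots> \<longleftrightarrow> (\<forall>u\<in>carrier_mat 1 n. u = u * M \<longrightarrow> u = 0\<^sub>m 1 n)"
    using fix_iff zero_iff by blast
  finally show ?thesis .
qed


section \<open>Block matrices\<close>

text \<open>An arbitrary family of blocks replaces the family \<open>T (mat_block s X i j)\<close>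
  of \<open>map_blocks\<close>, so that sums and products of such matrices keep the same
  form.\<close>

definition mat_of_blocks ::
  "nat \<Rightarrow> nat \<Rightarrow> nat \<Rightarrow> (nat \<Rightarrow> nat \<Rightarrow> 'a mat) \<Rightarrow> 'a mat" where
  "mat_of_blocks p q m F =
    mat (p * m) (q * m) (\<lambda>(i, j). F (i div p) (j div q) $$ (i mod p, j mod q))"

lemma mat_of_blocks_carrier [simp]: "mat_of_blocks p q m F \<in> carrier_mat (p * m) (q * m)"
  by (simp add: mat_of_blocks_def)

lemma mat_block_carrier [simp]: "mat_block s X i j \<in> carrier_mat s s"
  by (simp add: mat_block_def)

lemma map_blocks_eq_mat_of_blocks:
  "map_blocks s p q m T X = mat_of_blocks p q m (\<lambda>i j. T (mat_block s X i j))"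
  by (simp add: map_blocks_def mat_of_blocks_def)

text \<open>The bound \<open>i < p * m\<close> excludes \<open>p = 0\<close>, which makes the
  remainder a genuine position inside a block. Blocks of size 0 are thereby covered without a case
  distinction.\<close>

lemma block_index:
  fixes i :: nat
  assumes "i < p * m"
  shows "i div p < m" "i mod p < p"
  using assms by (auto simp: less_mult_imp_div_less mult.commute intro!: mod_less_divisor gr0I)

lemma block_index_less:
  fixes i :: nat
  assumes "i < m" "a < s"
  shows "i * s + a < s * m"
proof -
  have "i * s + a < Suc i * s" using assms by simp
  also have "\<dots> \<le> m * s" using assms by (intro mult_right_mono) auto
  finally show ?thesis by (simp add: mult.commute)
qed

lemma mat_of_blocks_cong:
  assumes "\<And>i j. i < m \<Longrightarrow> j < m \<Longrightarrow> F i j = G i j"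
  shows "mat_of_blocks p q m F = mat_of_blocks p q m G"
  unfolding mat_of_blocks_def by (rule cong_mat) (auto simp: assms block_index)

lemma mat_of_blocks_add:
  assumes "\<And>i j. i < m \<Longrightarrow> j < m \<Longrightarrow> F i j \<in> carrier_mat p q"
    and "\<And>i j. i < m \<Longrightarrow> j < m \<Longrightarrow> G i j \<in> carrier_mat p q"
  shows "mat_of_blocks p q m F + mat_of_blocks p q m G = mat_of_blocks p q m (\<lambda>i j. F i j + G i j)"
  using carrier_matD[OF assms(2)]
  by (intro eq_matI) (auto simp: mat_of_blocks_def block_index)

lemma mat_of_blocks_minus:
  assumes "\<And>i j. i < m \<Longrightarrow> j < m \<Longrightarrow> F i j \<in> carrier_mat p q"
    and "\<And>i j. i < m \<Longrightarrow> j < m \<Longrightarrow> G i j \<in> carrier_mat p q"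
  shows "mat_of_blocks p q m F - mat_of_blocks p q m G = mat_of_blocks p q m (\<lambda>i j. F i j - G i j)"
  using carrier_matD[OF assms(2)]
  by (intro eq_matI) (auto simp: mat_of_blocks_def block_index)

lemma mat_sum_mat_of_blocks:
  fixes F :: "nat \<Rightarrow> nat \<Rightarrow> nat \<Rightarrow> 'a::field mat"
  assumes F: "\<And>k i j. k < d \<Longrightarrow> i < m \<Longrightarrow> j < m \<Longrightarrow> F k i j \<in> carrier_mat p q"
  shows "mat_sum (p * m) (q * m) d (\<lambda>k. mat_of_blocks p q m (F k)) =
    mat_of_blocks p q m (\<lambda>i j. mat_sum p q d (\<lambda>k. F k i j))"
proof -
  have c: "mat_sum (p * m) (q * m) d (\<lambda>k. mat_of_blocks p q m (F k)) \<in> carrier_mat (p * m) (q * m)"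
    by (rule mat_sum_carrier) simp
  show ?thesis
  proof (rule eq_matI)
    fix i j
    assume "i < dim_row (mat_of_blocks p q m (\<lambda>i j. mat_sum p q d (\<lambda>k. F k i j)))"
      and "j < dim_col (mat_of_blocks p q m (\<lambda>i j. mat_sum p q d (\<lambda>k. F k i j)))"
    then have ij: "i < p * m" "j < q * m" by (auto simp: mat_of_blocks_def)
    have "mat_sum (p * m) (q * m) d (\<lambda>k. mat_of_blocks p q m (F k)) $$ (i, j)
      = (\<Sum>k<d. mat_of_blocks p q m (F k) $$ (i, j))"
      by (rule index_mat_sum) (use ij in auto)
    also have "\<dots> = (\<Sum>k<d. F k (i div p) (j div q) $$ (i mod p, j mod q))"
      using ij by (simp add: mat_of_blocks_def)
    also have "\<dots> = mat_sum p q d (\<lambda>k. F k (i div p) (j div q)) $$ (i mod p, j mod q)"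
      by (rule index_mat_sum[symmetric]) (use ij F block_index in auto)
    finally show "mat_sum (p * m) (q * m) d (\<lambda>k. mat_of_blocks p q m (F k)) $$ (i, j)
      = mat_of_blocks p q m (\<lambda>i j. mat_sum p q d (\<lambda>k. F k i j)) $$ (i, j)"
      using ij by (simp add: mat_of_blocks_def)
  qed (use c in \<open>auto simp: mat_of_blocks_def\<close>)
qed

text \<open>Writing \<open>l = k * q + c\<close> splits an index into the number \<open>k\<close> of
  its block and the position \<open>c\<close> inside it; each run of \<open>q\<close> consecutive
  indices shares one quotient.\<close>

lemma sum_div_mod:
  fixes f :: "nat \<Rightarrow> nat \<Rightarrow> 'a::comm_monoid_add"
  shows "(\<Sum>l<q * m. f (l div q) (l mod q)) = (\<Sum>k<m. \<Sum>c<q. f k c)"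
proof -
  have "(\<Sum>l\<in>{k * q..<k * q + q}. f (l div q) (l mod q)) = (\<Sum>c<q. f k c)" for k
    using sum.shift_bounds_nat_ivl[of "\<lambda>l. f (l div q) (l mod q)" 0 "k * q" q]
    by (simp add: add.commute lessThan_atLeast0)
  then show ?thesis
    using sum.nat_group[of "\<lambda>l. f (l div q) (l mod q)" q m] by (simp add: mult.commute)
qed

text \<open>The inner index of the product runs below \<open>q * m\<close>. Grouped by its quotient
  modulo \<open>q\<close>, the sum becomes a sum over \<open>k\<close> of entries of
  \<open>F i k * G k j\<close>.\<close>

lemma mult_mat_of_blocks:
  fixes F G :: "nat \<Rightarrow> nat \<Rightarrow> 'a::field mat"
  assumes F: "\<And>i j. i < m \<Longrightarrow> j < m \<Longrightarrow> F i j \<in> carrier_mat p q"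
    and G: "\<And>i j. i < m \<Longrightarrow> j < m \<Longrightarrow> G i j \<in> carrier_mat q r"
  shows "mat_of_blocks p q m F * mat_of_blocks q r m G =
    mat_of_blocks p r m (\<lambda>i j. mat_sum p r m (\<lambda>k. F i k * G k j))"
proof (rule eq_matI)
  fix i j
  assume "i < dim_row (mat_of_blocks p r m (\<lambda>i j. mat_sum p r m (\<lambda>k. F i k * G k j)))"
    and "j < dim_col (mat_of_blocks p r m (\<lambda>i j. mat_sum p r m (\<lambda>k. F i k * G k j)))"
  then have ij: "i < p * m" "j < r * m" by (auto simp: mat_of_blocks_def)
  define i1 i2 j1 j2 where "i1 = i div p" "i2 = i mod p" "j1 = j div r" "j2 = j mod r"
  have lt: "i1 < m" "i2 < p" "j1 < m" "j2 < r"
    using ij block_index by (auto simp: i1_i2_j1_j2_def)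
  have "(mat_of_blocks p q m F * mat_of_blocks q r m G) $$ (i, j)
    = (\<Sum>l<q * m. F i1 (l div q) $$ (i2, l mod q) * G (l div q) j1 $$ (l mod q, j2))"
    using ij by (auto simp: mat_of_blocks_def scalar_prod_def i1_i2_j1_j2_def lessThan_atLeast0)
  also have "\<dots> = (\<Sum>k<m. \<Sum>c<q. F i1 k $$ (i2, c) * G k j1 $$ (c, j2))"
    by (rule sum_div_mod)
  also have "\<dots> = (\<Sum>k<m. (F i1 k * G k j1) $$ (i2, j2))"
  proof (rule sum.cong)
    fix k assume "k \<in> {..<m}"
    then have "F i1 k \<in> carrier_mat p q" "G k j1 \<in> carrier_mat q r" using F G lt by auto
    then show "(\<Sum>c<q. F i1 k $$ (i2, c) * G k j1 $$ (c, j2)) = (F i1 k * G k j1) $$ (i2, j2)"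
      using lt by (auto simp: scalar_prod_def lessThan_atLeast0)
  qed simp
  also have "\<dots> = mat_sum p r m (\<lambda>k. F i1 k * G k j1) $$ (i2, j2)"
    by (rule index_mat_sum[symmetric]; use F G lt in \<open>blast intro: mult_carrier_mat\<close>)
  finally show "(mat_of_blocks p q m F * mat_of_blocks q r m G) $$ (i, j)
    = mat_of_blocks p r m (\<lambda>i j. mat_sum p r m (\<lambda>k. F i k * G k j)) $$ (i, j)"
    using ij by (simp add: mat_of_blocks_def i1_i2_j1_j2_def)
qed (auto simp: mat_of_blocks_def)

lemma mat_of_blocks_mat_block:
  assumes "X \<in> carrier_mat (s * m) (s * m)"
  shows "mat_of_blocks s s m (mat_block s X) = X"
  using assms
  by (intro eq_matI) (auto simp: mat_of_blocks_def mat_block_def block_index)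

lemma mat_block_mat_of_blocks:
  assumes "i < m" "j < m" "F i j \<in> carrier_mat s s"
  shows "mat_block s (mat_of_blocks s s m F) i j = F i j"
  using assms
  by (intro eq_matI) (auto simp: mat_of_blocks_def mat_block_def block_index_less)

text \<open>Both factors are assembled from their blocks, multiplied as block matrices, and cut up
  again.\<close>

lemma mat_block_mult:
  fixes X Z :: "'a::field mat"
  assumes "X \<in> carrier_mat (s * m) (s * m)" "Z \<in> carrier_mat (s * m) (s * m)" "i < m" "j < m"
  shows "mat_block s (X * Z) i j = mat_sum s s m (\<lambda>k. mat_block s X i k * mat_block s Z k j)"
proof -
  have "X * Z = mat_of_blocks s s m (mat_block s X) * mat_of_blocks s s m (mat_block s Z)"
    using assms by (simp add: mat_of_blocks_mat_block)
  also have "\<dots> = mat_of_blocks s s m (\<lambda>i j. mat_sum s s m (\<lambda>k. mat_block s X i k * mat_block s Z k j))"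
    by (rule mult_mat_of_blocks) auto
  finally show ?thesis
    using assms(3,4) by (simp add: mat_block_mat_of_blocks mat_sum_carrier mult_carrier_mat[of _ s s])
qed

lemma mat_block_add:
  assumes "X \<in> carrier_mat (s * m) (s * m)" "Z \<in> carrier_mat (s * m) (s * m)" "i < m" "j < m"
  shows "mat_block s (X + Z) i j = mat_block s X i j + mat_block s Z i j"
  using assms by (intro eq_matI) (auto simp: mat_block_def block_index_less)

lemma mat_block_minus:
  assumes "X \<in> carrier_mat (s * m) (s * m)" "Z \<in> carrier_mat (s * m) (s * m)" "i < m" "j < m"
  shows "mat_block s (X - Z) i j = mat_block s X i j - mat_block s Z i j"
  using assms by (intro eq_matI) (auto simp: mat_block_def block_index_less)

lemma mat_block_kronecker_one:
  fixes Y :: "'a::field mat"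
  assumes "Y \<in> carrier_mat s s" "i < m" "j < m"
  shows "mat_block s (kronecker (1\<^sub>m m) Y) i j = (if i = j then Y else 0\<^sub>m s s)"
  using assms
  by (intro eq_matI) (auto simp: mat_block_def kronecker_def block_index_less mult.commute[of m s])

lemma kronecker_one_carrier:
  "Y \<in> carrier_mat s s \<Longrightarrow> kronecker (1\<^sub>m m) Y \<in> carrier_mat (s * m) (s * m)"
  by (auto simp: kronecker_def mult.commute)

lemma mat_sum_single:
  fixes M :: "nat \<Rightarrow> 'a::field mat"
  assumes "l < d" "M l \<in> carrier_mat nr nc" "\<And>k. k < d \<Longrightarrow> k \<noteq> l \<Longrightarrow> M k = 0\<^sub>m nr nc"
  shows "mat_sum nr nc d M = M l"
proof -
  have M: "M k \<in> carrier_mat nr nc" if "k < d" for k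
    using assms(2) assms(3)[of k] that by (cases "k = l") auto
  have "mat_sum nr nc d M $$ (i, j) = M l $$ (i, j)" if "i < nr" "j < nc" for i j
  proof -
    have "(\<Sum>k<d. M k $$ (i, j)) = (\<Sum>k<d. if k = l then M l $$ (i, j) else 0)"
      by (rule sum.cong) (use assms(3) that in auto)
    then show ?thesis
      using index_mat_sum[of d M, OF M that] assms(1) by simp
  qed
  then show ?thesis
    using mat_sum_carrier[of d M, OF M] assms(2) by (intro eq_matI) auto
qed

text \<open>The Kronecker product is block diagonal with all diagonal blocks equal to
  \<open>Y\<close>, so in each block of the two products a single summand survives. Hence the
  commutator can be formed block by block, which is what carries a condition on \<open>s x s\<close>
  matrices to every level \<open>m\<close>.\<close>

lemma mat_block_commutator_kronecker:
  fixes S Y :: "'a::field mat"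
  assumes S: "S \<in> carrier_mat (s * m) (s * m)" and Y: "Y \<in> carrier_mat s s" and ij: "i < m" "j < m"
  shows "mat_block s (mat_commutator S (kronecker (1\<^sub>m m) Y)) i j = mat_commutator (mat_block s S i j) Y"
proof -
  let ?K = "kronecker (1\<^sub>m m) Y"
  note K = kronecker_one_carrier[OF Y, of m]
  have 1: "mat_block s (S * ?K) i j = mat_block s S i j * Y"
    unfolding mat_block_mult[OF S K ij]
    by (subst mat_sum_single[of j])
      (use ij Y in \<open>auto simp: mat_block_kronecker_one mult_carrier_mat[of _ s s] right_mult_zero_mat[of _ s s]\<close>)
  have 2: "mat_block s (?K * S) i j = Y * mat_block s S i j"
    unfolding mat_block_mult[OF K S ij]
    by (subst mat_sum_single[of i])
      (use ij Y in \<open>auto simp: mat_block_kronecker_one mult_carrier_mat[of _ s s] left_mult_zero_mat[of _ s s]\<close>)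
  show ?thesis
    unfolding mat_commutator_def 1[symmetric] 2[symmetric]
    by (rule mat_block_minus[OF _ _ ij]) (use S K in auto)
qed

lemma mat_sum_swap:
  fixes M :: "nat \<Rightarrow> nat \<Rightarrow> 'a::field mat"
  assumes M: "\<And>k l. k < d \<Longrightarrow> l < e \<Longrightarrow> M k l \<in> carrier_mat nr nc"
  shows "mat_sum nr nc d (\<lambda>k. mat_sum nr nc e (M k)) = mat_sum nr nc e (\<lambda>l. mat_sum nr nc d (\<lambda>k. M k l))"
proof -
  have in1: "mat_sum nr nc e (M k) \<in> carrier_mat nr nc" if "k < d" for k
    by (rule mat_sum_carrier) (use M that in auto)
  have in2: "mat_sum nr nc d (\<lambda>k. M k l) \<in> carrier_mat nr nc" if "l < e" for l
    by (rule mat_sum_carrier) (use M that in auto)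
  have out: "mat_sum nr nc d (\<lambda>k. mat_sum nr nc e (M k)) \<in> carrier_mat nr nc"
    "mat_sum nr nc e (\<lambda>l. mat_sum nr nc d (\<lambda>k. M k l)) \<in> carrier_mat nr nc"
    by (rule mat_sum_carrier, use in1 in2 in blast)+
  show ?thesis
  proof (rule eq_matI)
    fix i j
    assume "i < dim_row (mat_sum nr nc e (\<lambda>l. mat_sum nr nc d (\<lambda>k. M k l)))"
      and "j < dim_col (mat_sum nr nc e (\<lambda>l. mat_sum nr nc d (\<lambda>k. M k l)))"
    then have ij: "i < nr" "j < nc" using out by auto
    show "mat_sum nr nc d (\<lambda>k. mat_sum nr nc e (M k)) $$ (i, j)
      = mat_sum nr nc e (\<lambda>l. mat_sum nr nc d (\<lambda>k. M k l)) $$ (i, j)"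
      using ij by (simp add: index_mat_sum in1 in2 M sum.swap[of _ "{..<d}"])
  qed (use out in auto)
qed

section \<open>Linear maps extended to block matrices\<close>

lemma map_blocks_add:
  assumes T: "T \<in> mat_linear_maps s p q"
    and "X \<in> carrier_mat (s * m) (s * m)" "Z \<in> carrier_mat (s * m) (s * m)"
  shows "map_blocks s p q m T (X + Z) = map_blocks s p q m T X + map_blocks s p q m T Z"
proof -
  have "map_blocks s p q m T (X + Z)
    = mat_of_blocks p q m (\<lambda>i j. T (mat_block s X i j) + T (mat_block s Z i j))"
    unfolding map_blocks_eq_mat_of_blocks
    by (rule mat_of_blocks_cong) (use assms in \<open>simp add: mat_block_add mat_linear_maps_add[OF T]\<close>)
  also have "\<dots> = map_blocks s p q m T X + map_blocks s p q m T Z"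
    unfolding map_blocks_eq_mat_of_blocks
    by (rule mat_of_blocks_add[symmetric]) (auto intro: mat_linear_maps_carrier[OF T])
  finally show ?thesis .
qed

text \<open>Block \<open>(p, t)\<close> of each of the three products is a double sum over the inner
  block indices \<open>r\<close> and \<open>q\<close>, and the \<open>s x s\<close> condition holds
  summand by summand for the triple \<open>Z_pr\<close>, \<open>S_rq\<close>, \<open>W_qt\<close>.
  This works because every term is additive in \<open>S\<close> and the condition is assumed for all
  \<open>s x s\<close> matrices, hence for each block of \<open>S\<close>, invertible or
  not.\<close>

lemma map_blocks_abbey:
  fixes A :: "nat \<Rightarrow> 'a::field mat \<Rightarrow> 'a mat" and Y :: "nat \<Rightarrow> 'a mat"
  assumes A: "\<And>k. k < d \<Longrightarrow> A k \<in> mat_linear_maps s L L"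
    and Y: "\<And>k. k < d \<Longrightarrow> Y k \<in> carrier_mat s s"
    and abbey: "\<And>i j S Z W. i < d \<Longrightarrow> j < d \<Longrightarrow> S \<in> carrier_mat s s \<Longrightarrow>
      Z \<in> carrier_mat s s \<Longrightarrow> W \<in> carrier_mat s s \<Longrightarrow>
      A i (Z * S) * A j W - A i Z * A j (S * W) =
      A i Z * mat_sum L L d (\<lambda>k. A k (mat_commutator S (Y k))) * A j W"
    and i: "i < d" and j: "j < d"
    and S: "S \<in> carrier_mat (s * m) (s * m)"
    and Z: "Z \<in> carrier_mat (s * m) (s * m)" and W: "W \<in> carrier_mat (s * m) (s * m)"
  shows "map_blocks s L L m (A i) (Z * S) * map_blocks s L L m (A j) W
      - map_blocks s L L m (A i) Z * map_blocks s L L m (A j) (S * W)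
    = map_blocks s L L m (A i) Z
      * mat_sum (L * m) (L * m) d (\<lambda>k. map_blocks s L L m (A k) (mat_commutator S (kronecker (1\<^sub>m m) (Y k))))
      * map_blocks s L L m (A j) W"
proof -
  let ?Z = "mat_block s Z" and ?S = "mat_block s S" and ?W = "mat_block s W"
  \<comment> \<open>\<open>c r q\<close> is block \<open>(r, q)\<close> of the sum of the extended
    maps at the commutators with the extended centre.\<close>
  define c where "c r q = mat_sum L L d (\<lambda>k. A k (mat_commutator (?S r q) (Y k)))" for r q
  note Ac = mat_linear_maps_carrier[OF A]
  have blk: "?Z a b * ?S e f \<in> carrier_mat s s" "?S a b * ?W e f \<in> carrier_mat s s" for a b e f
    by (auto intro: mult_carrier_mat[of _ s s])
  have Ai: "A i (?Z a b) \<in> carrier_mat L L" "A i (?Z a b * ?S e f) \<in> carrier_mat L L" for a b e f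
    using Ac[OF i] blk by auto
  have Aj: "A j (?W a b) \<in> carrier_mat L L" "A j (?S a b * ?W e f) \<in> carrier_mat L L" for a b e f
    using Ac[OF j] blk by auto
  have comm: "mat_commutator (?S r q) (Y k) \<in> carrier_mat s s" if "k < d" for r q k
    using Y[OF that] by (auto simp: mat_commutator_def intro!: minus_carrier_mat)
  have c: "c r q \<in> carrier_mat L L" for r q
    unfolding c_def by (rule mat_sum_carrier) (use Ac comm in auto)
  have mult: "P * Q \<in> carrier_mat L L" if "P \<in> carrier_mat L L" "Q \<in> carrier_mat L L" for P Q :: "'a mat"
    using that by auto
  have sum: "mat_sum L L m f \<in> carrier_mat L L" if "\<And>k. f k \<in> carrier_mat L L" for f :: "nat \<Rightarrow> 'a mat"
    by (rule mat_sum_carrier) (rule that)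
  have A_sum: "A k (mat_sum s s m f) = mat_sum L L m (\<lambda>r. A k (f r))"
    if "k < d" "\<And>r. f r \<in> carrier_mat s s" for k f
    by (rule additive_mat_sum[where T = "A k"])
      (use that in \<open>auto intro: Ac mat_linear_maps_add[OF A]\<close>)
  let ?ZSW = "\<lambda>p t q r. A i (?Z p r * ?S r q) * A j (?W q t)"
  let ?Z_SW = "\<lambda>p t q r. A i (?Z p r) * A j (?S r q * ?W q t)"
  let ?ZcW = "\<lambda>p t q r. A i (?Z p r) * c r q * A j (?W q t)"
  let ?sum = "\<lambda>g. mat_of_blocks L L m (\<lambda>p t. mat_sum L L m (\<lambda>q. mat_sum L L m (\<lambda>r. g p t q r)))"
  have 1: "map_blocks s L L m (A i) (Z * S) * map_blocks s L L m (A j) W = ?sum ?ZSW"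
  proof -
    have "map_blocks s L L m (A i) (Z * S)
      = mat_of_blocks L L m (\<lambda>p q. mat_sum L L m (\<lambda>r. A i (?Z p r * ?S r q)))"
      unfolding map_blocks_eq_mat_of_blocks
      by (rule mat_of_blocks_cong) (simp add: mat_block_mult[OF Z S] A_sum i blk)
    then have "map_blocks s L L m (A i) (Z * S) * map_blocks s L L m (A j) W
      = mat_of_blocks L L m (\<lambda>p t. mat_sum L L m (\<lambda>q. mat_sum L L m (\<lambda>r. A i (?Z p r * ?S r q)) * A j (?W q t)))"
      unfolding map_blocks_eq_mat_of_blocks[of _ _ _ _ _ W]
      by (simp add: mult_mat_of_blocks sum Ai Aj)
    then show ?thesis by (simp add: mat_sum_mult[OF Aj(1)] Ai)
  qed
  have 2: "map_blocks s L L m (A i) Z * map_blocks s L L m (A j) (S * W) = ?sum ?Z_SW"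
  proof -
    have "map_blocks s L L m (A j) (S * W)
      = mat_of_blocks L L m (\<lambda>r t. mat_sum L L m (\<lambda>q. A j (?S r q * ?W q t)))"
      unfolding map_blocks_eq_mat_of_blocks
      by (rule mat_of_blocks_cong) (simp add: mat_block_mult[OF S W] A_sum j blk)
    then have "map_blocks s L L m (A i) Z * map_blocks s L L m (A j) (S * W)
      = mat_of_blocks L L m (\<lambda>p t. mat_sum L L m (\<lambda>r. A i (?Z p r) * mat_sum L L m (\<lambda>q. A j (?S r q * ?W q t))))"
      unfolding map_blocks_eq_mat_of_blocks[of _ _ _ _ _ Z]
      by (simp add: mult_mat_of_blocks sum Ai Aj)
    also have "\<dots> = mat_of_blocks L L m (\<lambda>p t. mat_sum L L m (\<lambda>r. mat_sum L L m (\<lambda>q. ?Z_SW p t q r)))"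
      by (simp add: mult_mat_sum[OF Ai(1)] Aj)
    \<comment> \<open>Expanding \<open>S * W\<close> inside \<open>A j\<close> has put the sum over
      \<open>q\<close> inside the sum over \<open>r\<close>; the swap restores the order used in the
      other two products.\<close>
    also have "\<dots> = ?sum ?Z_SW"
      by (rule mat_of_blocks_cong, rule mat_sum_swap) (intro mult Ai Aj)
    finally show ?thesis .
  qed
  have "mat_sum (L * m) (L * m) d (\<lambda>k. map_blocks s L L m (A k) (mat_commutator S (kronecker (1\<^sub>m m) (Y k))))
    = mat_sum (L * m) (L * m) d (\<lambda>k. mat_of_blocks L L m (\<lambda>r q. A k (mat_commutator (?S r q) (Y k))))"
    unfolding map_blocks_eq_mat_of_blocks
    by (rule mat_sum_cong, rule mat_of_blocks_cong)
      (auto simp: mat_block_commutator_kronecker[OF S Y])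
  also have "\<dots> = mat_of_blocks L L m c"
    unfolding c_def by (rule mat_sum_mat_of_blocks) (use Ac comm in auto)
  finally have 3: "map_blocks s L L m (A i) Z
      * mat_sum (L * m) (L * m) d (\<lambda>k. map_blocks s L L m (A k) (mat_commutator S (kronecker (1\<^sub>m m) (Y k))))
      * map_blocks s L L m (A j) W = ?sum ?ZcW"
    unfolding map_blocks_eq_mat_of_blocks[of _ _ _ _ _ Z] map_blocks_eq_mat_of_blocks[of _ _ _ _ _ W]
    by (simp add: mult_mat_of_blocks sum mult Ai Aj c mat_sum_mult[OF Aj(1)])
  have "mat_sum L L m (\<lambda>q. mat_sum L L m (\<lambda>r. ?ZSW p t q r))
      - mat_sum L L m (\<lambda>q. mat_sum L L m (\<lambda>r. ?Z_SW p t q r))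
    = mat_sum L L m (\<lambda>q. mat_sum L L m (\<lambda>r. ?ZSW p t q r - ?Z_SW p t q r))" for p t
    by (simp add: mat_sum_minus sum mult Ai Aj)
  then have "?sum ?ZSW - ?sum ?Z_SW = ?sum (\<lambda>p t q r. ?ZSW p t q r - ?Z_SW p t q r)"
    by (simp add: mat_of_blocks_minus sum mult Ai Aj)
  \<comment> \<open>With all sums in the same order, the \<open>s x s\<close> condition is applied
    to each summand.\<close>
  also have "\<dots> = ?sum ?ZcW"
    by (simp add: abbey[OF i j] c_def)
  finally show ?thesis unfolding 1 2 3 .
qed

section \<open>Similarity invariance of the domain\<close>

theorem theorem3p5:
  fixes s d L :: nat
    and Y :: "nat \<Rightarrow> 'a::field mat"
    and C D :: "'a mat"
    and A B :: "nat \<Rightarrow> 'a mat \<Rightarrow> 'a mat"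
  assumes "fm_realization s d Y L D C A B"
    and "fm_controllable s d L A B"
    and "fm_observable s d L C A"
    and "linearized_lost_abbey s d Y L D C A B"
  shows "similarity_invariant s (fm_Omega s d Y L A)"
proof -
  have Y: "Y k \<in> carrier_mat s s" and A: "A k \<in> mat_linear_maps s L L" if "k < d" for k
    using assms(1) that by (auto simp: fm_realization_def)
  have abbey: "A i (Z * S) * A j W - A i Z * A j (S * W) =
      A i Z * mat_sum L L d (\<lambda>k. A k (mat_commutator S (Y k))) * A j W"
    if "i < d" "j < d" "S \<in> carrier_mat s s" "Z \<in> carrier_mat s s" "W \<in> carrier_mat s s" for i j S Z W
    using assms(4) that unfolding linearized_lost_abbey_def Let_def by blast
  have "det (fm_Lambda s d Y L A m (\<lambda>k. S * X k * T)) \<noteq> 0"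
    if S: "S \<in> carrier_mat (s * m) (s * m)" and T: "T \<in> carrier_mat (s * m) (s * m)"
      and inv: "inverts_mat S T" "inverts_mat T S"
      and X: "\<And>k. k < d \<Longrightarrow> X k \<in> carrier_mat (s * m) (s * m)"
      and det: "det (fm_Lambda s d Y L A m X) \<noteq> 0"
    for m S T X
  proof -
    let ?E = "\<lambda>k. map_blocks s L L m (A k)" and ?Y = "\<lambda>k. kronecker (1\<^sub>m m) (Y k)"
    have E: "?E k Z \<in> carrier_mat (L * m) (L * m)" for k Z
      by (simp add: map_blocks_eq_mat_of_blocks)
    \<comment> \<open>The criterion is stated for every tuple because it is used twice: for the
      given \<open>X\<close> as a hypothesis and for its conjugate as the goal.\<close>
    have Lambda: "det (fm_Lambda s d Y L A m X) \<noteq> 0 \<longleftrightarrow>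
      (\<forall>u\<in>carrier_mat 1 (L * m). u = u * mat_sum (L * m) (L * m) d (\<lambda>k. ?E k (X k - ?Y k)) \<longrightarrow>
        u = 0\<^sub>m 1 (L * m))" for X
      unfolding fm_Lambda_def
      by (rule det_one_minus_nonzero_iff, rule mat_sum_carrier, rule E)
    show ?thesis
      unfolding Lambda
    proof (intro ballI impI)
      fix v :: "'a mat"
      assume v: "v \<in> carrier_mat 1 (L * m)"
        "v = v * mat_sum (L * m) (L * m) d (\<lambda>k. ?E k (S * X k * T - ?Y k))"
      show "v = 0\<^sub>m 1 (L * m)"
      proof (rule kernel_transfer[where S = S and T = T and X = X and E = ?E and Y = ?Y and d = d])
        show "S * T = 1\<^sub>m (s * m)" "T * S = 1\<^sub>m (s * m)"
          using inv S T by (auto simp: inverts_mat_def)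
        show "?E k (Z + W) = ?E k Z + ?E k W"
          if "k < d" "Z \<in> carrier_mat (s * m) (s * m)" "W \<in> carrier_mat (s * m) (s * m)" for k Z W
          by (rule map_blocks_add[OF A]) (use that in auto)
        show "?E i (Z * S) * ?E j W - ?E i Z * ?E j (S * W) =
            ?E i Z * mat_sum (L * m) (L * m) d (\<lambda>k. ?E k (mat_commutator S (?Y k))) * ?E j W"
          if "i < d" "j < d" "Z \<in> carrier_mat (s * m) (s * m)" "W \<in> carrier_mat (s * m) (s * m)" for i j Z W
          by (rule map_blocks_abbey[OF A Y abbey]) (use that S in auto)
        show "u = 0\<^sub>m 1 (L * m)" if "u \<in> carrier_mat 1 (L * m)"
            "u = u * mat_sum (L * m) (L * m) d (\<lambda>k. ?E k (X k - ?Y k))" for u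
          using det that unfolding Lambda by blast
      qed (use S T X E v Y in \<open>auto intro!: kronecker_one_carrier\<close>)
    qed
  qed
  \<comment> \<open>Besides the determinant condition, membership asks that the conjugated matrices
    have size \<open>s * m\<close>; this is closure of the carrier under products.\<close>
  then show ?thesis
    unfolding similarity_invariant_def fm_Omega_def fm_Omega_level_def
    by simp (blast intro: mult_carrier_mat)
qed

end
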